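(* Let $r_J\ge0$ be fixed and let $\hat m\in\hat{\mathcal M}_1(r_J)\cap\bigcap_{r\ge0}\hat{\mathcal M}_2(r)$. If the rate $r_I\ge 0$ satisfies $$r_I\le\frac{f^{-1}\Big[B(\hat m)\,e^{-u\delta\psi(\hat a_1(r_J))}\big(e^{u(1+r_J)(D+\hat a_1(r_J))}-1\big)\Big]}{D+\hat a_1(r_J)}-1,$$ then $\hat I^2(\hat m)\ge\hat I^1(\hat m)$, i.e. the better contract for firm $I$ is the second one (debt issuance).
   Context: Standing assumptions. $u,v>0$; $D>0$, $r_I,r_J\ge 0$, $\delta\in\mathbb R$, $x^+=\max(x,0)$. $\mu$ is a non-constant real random variable bounded from below by a finite constant $\underline\mu$, with $\mathbb E[e^{\lambda\mu}]<\infty$ for all $\lambda\in\mathbb R$. $\varphi,\psi:\mathbb R_+\to\mathbb R_+$ are $C^1$, increasing, strictly concave, $\varphi'(0)=\psi'(0)=+\infty$, $\varphi'(\infty)=\psi'(\infty)=0$, $\varphi(\infty)+\delta^+\psi(\infty)<\underline\mu$, and $(\varphi')^{-1}(x)\sim(\psi')^{-1}(x)$ as $x\to0$. $g:\mathbb R_+\to\mathbb R$ is $C^1$, increasing, strictly concave, $g'(0)=\infty$, $g'(\infty)=0$, and $m_0:=\inf\{m>0:g(m)>0\}<\infty$. $b^a,b^m,b^e:\mathbb R_+\to\mathbb R_+$ are $C^1$, increasing, concave; $(b^a)'(0)>0$ (possibly infinite), $(b^a)'(\infty)=0$, $b^a(\infty)<\infty$; $(b^m)'(0)=(b^e)'(0)=\infty$,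 $(b^m)'(\infty)=(b^e)'(\infty)=0$. $f:\mathbb R_+\to\mathbb R$ is differentiable, increasing, strictly convex, $f'(\infty)=\infty$; $f^{-1}$ is its inverse (the condition in the claim presupposes that its argument lies in the range of $f$). For $r\ge0$, $F_r(a)=b^a(a)-f((1+r)(D+a))$; it is assumed that $F_{r_I}'(0)>0$ (possibly infinite). Conventions: $(\phi')^{-1}(+\infty)=0$ for $\phi=\varphi,\psi,g$; $x/0=+\infty$ for $x>0$; $g(0)/g'(0)=0$. Notation. $e^*(\beta)=(\varphi')^{-1}\big(\frac1{(1-\beta)^+}\big)$; $C(\beta)=\frac1v\ln\mathbb E\big[e^{v(1-\beta)(\mu-\varphi(e^*(\beta)))}\big]$; $G(m)=\frac{g(m)}{g'(m)}-m$, and $G^{-1}:[-m_0,\infty)\to[m_0,\infty)$ is the inverse of the increasing bijection $G|_{[m_0,\infty)}$; $\hat\beta=\frac v{u+v}$, $\hat e=e^*(\hat\beta)=(\varphi')^{-1}(\frac{u+v}u)$; with $\mathrm{Id}$ the identity map, $B(m)=e^{u(\mathrm{Id}-b^m)(m)}\,e^{u(\mathrm{Id}-b^e)(\hat e)}\,e^{(u+v)C(\hat\beta)}$. Situation 1 (outsourcing of debt and exploitation): the Nash equilibria are parametrized by the maintenance effort $\hat m$ in $$\hat{\mathcal M}_1(r_J)=\Big[0,G^{-1}\Big(C(\hat\beta)+(1+r_J)(D+\hat a_1(r_J))+\hat e-\tfrac u{u+v}\delta\psi(\hat a_1(r_J))\Big)\Big],\quad \hat a_1(r_J)=(\psi')^{-1}\Big(\frac{(u+v)(1+r_J)}{\delta^+u}\Big),$$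 and the corresponding optimal value for firm $I$ is $$\hat I^1(\hat m)=b^a(\hat a_1(r_J))-e^{-u\delta\psi(\hat a_1(r_J))}e^{u(1+r_J)(D+\hat a_1(r_J))}B(\hat m).$$ Situation 2 (firm $I$ issues the debt, exploitation is outsourced): $\hat{\mathcal M}_2(r)$ is the set of $\hat m\ge0$ that are the maintenance effort of some Nash equilibrium in Situation 2 with interest rate $r$ for firm $I$, i.e. for which there is $\hat a\in\arg\max_{a\ge0}[F_r(a)-e^{-u\delta\psi(a)}B(\hat m)]$ with $C(\hat\beta)+\hat e-\frac u{u+v}\delta\psi(\hat a)-G(\hat m)\ge0$. The corresponding optimal value for firm $I$ (with rate $r_I$) is $\hat I^2(\hat m)=\max_{a\ge0}\big[F_{r_I}(a)-e^{-u\delta\psi(a)}B(\hat m)\big]$. *)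

theory Defs
  imports "HOL-Probability.Probability" "HOL-Library.Landau_Symbols"
begin

text \<open>
  Functions on the half-line of nonnegative reals are functions of type \<^typ>\<open>real \<Rightarrow> real\<close>
  of which only the values on \<^term>\<open>{0::real..}\<close> matter. Their derivatives may be infinite at 0.
  They are therefore extended reals, and at 0 they are one-sided.
\<close>

definition ext_deriv :: "(real \<Rightarrow> real) \<Rightarrow> real \<Rightarrow> ereal" where
  "ext_deriv h x = Lim (at x within {0..}) (\<lambda>y. ereal ((h y - h x) / (y - x)))"

text \<open>Of class \<open>C\<^sup>1\<close> on the half-line, an infinite derivative being allowed at 0 only.
  The second conjunct says that the limit in \<^const>\<open>ext_deriv\<close> exists.\<close>

definition C1_halfline :: "(real \<Rightarrow> real) \<Rightarrow> bool" where
  "C1_halfline h \<longleftrightarrow>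
     continuous_on {0..} h \<and>
     (\<forall>x\<ge>0. ((\<lambda>y. ereal ((h y - h x) / (y - x))) \<longlongrightarrow> ext_deriv h x) (at x within {0..})) \<and>
     (\<forall>x>0. \<bar>ext_deriv h x\<bar> \<noteq> \<infinity>) \<and>
     continuous_on {0..} (ext_deriv h)"

definition strictly_convex_on :: "real set \<Rightarrow> (real \<Rightarrow> real) \<Rightarrow> bool" where
  "strictly_convex_on S h \<longleftrightarrow> convex S \<and>
     (\<forall>x\<in>S. \<forall>y\<in>S. \<forall>t. x \<noteq> y \<longrightarrow> 0 < t \<longrightarrow> t < 1 \<longrightarrow>
        h ((1 - t) * x + t * y) < (1 - t) * h x + t * h y)"

definition strictly_concave_on :: "real set \<Rightarrow> (real \<Rightarrow> real) \<Rightarrow> bool" where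
  "strictly_concave_on S h \<longleftrightarrow> strictly_convex_on S (\<lambda>x. - h x)"

definition limit_at_infinity :: "(real \<Rightarrow> real) \<Rightarrow> ereal" where
  "limit_at_infinity h = Lim at_top (\<lambda>x. ereal (h x))"

text \<open>The inverse of the derivative. If \<^term>\<open>ext_deriv h 0 = \<infinity>\<close> and \<open>h\<close> is strictly concave,
  its value at \<open>\<infinity>\<close> is 0.\<close>

definition deriv_inverse :: "(real \<Rightarrow> real) \<Rightarrow> ereal \<Rightarrow> real" where
  "deriv_inverse h = inv_into {0..} (ext_deriv h)"

text \<open>In \<^typ>\<open>ereal\<close>, \<open>x / 0 = \<infinity>\<close> for \<open>x > 0\<close>, as wanted in the next definition
  for \<open>\<beta> \<ge> 1\<close> and in that of \<open>hat_a1\<close> for \<open>\<delta> \<le> 0\<close>.\<close>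

definition e_star :: "(real \<Rightarrow> real) \<Rightarrow> real \<Rightarrow> real" where
  "e_star \<phi> \<beta> = deriv_inverse \<phi> (1 / ereal (max (1 - \<beta>) 0))"

definition cost_C :: "'w measure \<Rightarrow> ('w \<Rightarrow> real) \<Rightarrow> (real \<Rightarrow> real) \<Rightarrow> real \<Rightarrow> real \<Rightarrow> real" where
  "cost_C M \<mu> \<phi> v \<beta> =
     1 / v * ln (\<integral>\<omega>. exp (v * (1 - \<beta>) * (\<mu> \<omega> - \<phi> (e_star \<phi> \<beta>))) \<partial>M)"

definition hat_beta :: "real \<Rightarrow> real \<Rightarrow> real" where
  "hat_beta u v = v / (u + v)"

definition hat_e :: "(real \<Rightarrow> real) \<Rightarrow> real \<Rightarrow> real \<Rightarrow> real" where
  "hat_e \<phi> u v = e_star \<phi> (hat_beta u v)"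

definition hat_a1 :: "(real \<Rightarrow> real) \<Rightarrow> real \<Rightarrow> real \<Rightarrow> real \<Rightarrow> real \<Rightarrow> real" where
  "hat_a1 \<psi> u v \<delta> r\<^sub>J =
     deriv_inverse \<psi> (ereal ((u + v) * (1 + r\<^sub>J)) / ereal (max \<delta> 0 * u))"

definition m0 :: "(real \<Rightarrow> real) \<Rightarrow> real" where
  "m0 g = Inf {m. 0 < m \<and> 0 < g m}"

text \<open>The division is the one of \<^typ>\<open>ereal\<close>, so that \<open>g 0 / \<infinity> = 0\<close>.\<close>

definition G_fun :: "(real \<Rightarrow> real) \<Rightarrow> real \<Rightarrow> real" where
  "G_fun g m = real_of_ereal (ereal (g m) / ext_deriv g m) - m"

definition G_inverse :: "(real \<Rightarrow> real) \<Rightarrow> real \<Rightarrow> real" where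
  "G_inverse g = inv_into {m0 g..} (G_fun g)"

definition B_fun ::
  "'w measure \<Rightarrow> ('w \<Rightarrow> real) \<Rightarrow> (real \<Rightarrow> real) \<Rightarrow> (real \<Rightarrow> real) \<Rightarrow> (real \<Rightarrow> real) \<Rightarrow>
   real \<Rightarrow> real \<Rightarrow> real \<Rightarrow> real" where
  "B_fun M \<mu> \<phi> bm be u v m =
     exp (u * (m - bm m)) * exp (u * (hat_e \<phi> u v - be (hat_e \<phi> u v))) *
     exp ((u + v) * cost_C M \<mu> \<phi> v (hat_beta u v))"

definition F_fun :: "(real \<Rightarrow> real) \<Rightarrow> (real \<Rightarrow> real) \<Rightarrow> real \<Rightarrow> real \<Rightarrow> real \<Rightarrow> real" where
  "F_fun ba f D r a = ba a - f ((1 + r) * (D + a))"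

text \<open>Situation 1: debt and exploitation are both outsourced.\<close>

definition hat_M1 ::
  "'w measure \<Rightarrow> ('w \<Rightarrow> real) \<Rightarrow> (real \<Rightarrow> real) \<Rightarrow> (real \<Rightarrow> real) \<Rightarrow> (real \<Rightarrow> real) \<Rightarrow>
   real \<Rightarrow> real \<Rightarrow> real \<Rightarrow> real \<Rightarrow> real \<Rightarrow> real set" where
  "hat_M1 M \<mu> \<phi> \<psi> g u v \<delta> D r\<^sub>J =
     {0 .. G_inverse g
        (cost_C M \<mu> \<phi> v (hat_beta u v) + (1 + r\<^sub>J) * (D + hat_a1 \<psi> u v \<delta> r\<^sub>J)
          + hat_e \<phi> u v - u / (u + v) * \<delta> * \<psi> (hat_a1 \<psi> u v \<delta> r\<^sub>J))}"

definition hat_I1 ::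
  "'w measure \<Rightarrow> ('w \<Rightarrow> real) \<Rightarrow> (real \<Rightarrow> real) \<Rightarrow> (real \<Rightarrow> real) \<Rightarrow>
   (real \<Rightarrow> real) \<Rightarrow> (real \<Rightarrow> real) \<Rightarrow> (real \<Rightarrow> real) \<Rightarrow>
   real \<Rightarrow> real \<Rightarrow> real \<Rightarrow> real \<Rightarrow> real \<Rightarrow> real \<Rightarrow> real" where
  "hat_I1 M \<mu> \<phi> \<psi> ba bm be u v \<delta> D r\<^sub>J m =
     ba (hat_a1 \<psi> u v \<delta> r\<^sub>J)
     - exp (- u * \<delta> * \<psi> (hat_a1 \<psi> u v \<delta> r\<^sub>J))
       * exp (u * (1 + r\<^sub>J) * (D + hat_a1 \<psi> u v \<delta> r\<^sub>J))
       * B_fun M \<mu> \<phi> bm be u v m"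

text \<open>Situation 2: firm I issues the debt and exploitation is outsourced. The next function is
  what firm I maximises over \<open>a \<ge> 0\<close>.\<close>

definition objective2 ::
  "'w measure \<Rightarrow> ('w \<Rightarrow> real) \<Rightarrow> (real \<Rightarrow> real) \<Rightarrow> (real \<Rightarrow> real) \<Rightarrow>
   (real \<Rightarrow> real) \<Rightarrow> (real \<Rightarrow> real) \<Rightarrow> (real \<Rightarrow> real) \<Rightarrow> (real \<Rightarrow> real) \<Rightarrow>
   real \<Rightarrow> real \<Rightarrow> real \<Rightarrow> real \<Rightarrow> real \<Rightarrow> real \<Rightarrow> real \<Rightarrow> real" where
  "objective2 M \<mu> \<phi> \<psi> ba bm be f u v \<delta> D r m a =
     F_fun ba f D r a - exp (- u * \<delta> * \<psi> a) * B_fun M \<mu> \<phi> bm be u v m"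

definition hat_M2 ::
  "'w measure \<Rightarrow> ('w \<Rightarrow> real) \<Rightarrow> (real \<Rightarrow> real) \<Rightarrow> (real \<Rightarrow> real) \<Rightarrow> (real \<Rightarrow> real) \<Rightarrow>
   (real \<Rightarrow> real) \<Rightarrow> (real \<Rightarrow> real) \<Rightarrow> (real \<Rightarrow> real) \<Rightarrow> (real \<Rightarrow> real) \<Rightarrow>
   real \<Rightarrow> real \<Rightarrow> real \<Rightarrow> real \<Rightarrow> real \<Rightarrow> real set" where
  "hat_M2 M \<mu> \<phi> \<psi> g ba bm be f u v \<delta> D r =
     {m. 0 \<le> m \<and>
       (\<exists>a. is_arg_max (objective2 M \<mu> \<phi> \<psi> ba bm be f u v \<delta> D r m) (\<lambda>a. 0 \<le> a) a \<and>
            cost_C M \<mu> \<phi> v (hat_beta u v) + hat_e \<phi> u v - u / (u + v) * \<delta> * \<psi> a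
              - G_fun g m \<ge> 0)}"

definition hat_I2 ::
  "'w measure \<Rightarrow> ('w \<Rightarrow> real) \<Rightarrow> (real \<Rightarrow> real) \<Rightarrow> (real \<Rightarrow> real) \<Rightarrow>
   (real \<Rightarrow> real) \<Rightarrow> (real \<Rightarrow> real) \<Rightarrow> (real \<Rightarrow> real) \<Rightarrow> (real \<Rightarrow> real) \<Rightarrow>
   real \<Rightarrow> real \<Rightarrow> real \<Rightarrow> real \<Rightarrow> real \<Rightarrow> real \<Rightarrow> real" where
  "hat_I2 M \<mu> \<phi> \<psi> ba bm be f u v \<delta> D r\<^sub>I m =
     (GREATEST y. y \<in> objective2 M \<mu> \<phi> \<psi> ba bm be f u v \<delta> D r\<^sub>I m ` {0..})"

end

theory Submission
  imports Defs
begin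

text \<open>
  Firm I may always choose the exploitation level \<open>a\<close> of Situation 1 in its problem of Situation 2.
  At that level the two objectives differ only in the cost \<open>f ((1 + r\<^sub>I) * (D + a))\<close>, which the
  condition on \<open>r\<^sub>I\<close> bounds by the extra compensation \<open>B * exp (- u \<delta> \<psi> a) * (exp (u (1 + r\<^sub>J) (D + a)) - 1)\<close>
  paid in Situation 1. That \<open>a \<ge> 0\<close> is the intermediate value theorem for the derivative of \<open>\<psi>\<close>,
  which decreases from \<open>\<infinity>\<close> to 0.
\<close>

text \<open>\<open>inv_into\<close> is unspecified outside the image, so the sign of its value is
  known only once \<open>c\<close> is shown to be attained on the half-line. The infinite derivative
  at 0 lies above every \<open>c\<close>; the value \<open>c = \<infinity>\<close> is therefore
  included.\<close>

lemma deriv_inverse_nonneg: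
  assumes "C1_halfline h" "ext_deriv h 0 = \<infinity>" "(ext_deriv h \<longlongrightarrow> 0) at_top" "0 < c"
  shows "0 \<le> deriv_inverse h c"
proof -
  have "eventually (\<lambda>x. ext_deriv h x < c \<and> 0 \<le> x) at_top"
    using order_tendstoD(2)[OF assms(3,4)] eventually_ge_at_top[of 0] by (rule eventually_conj)
  then obtain x where "ext_deriv h x < c" "0 \<le> x"
    using eventually_happens'[OF trivial_limit_at_top_linorder] by blast
  moreover have "continuous_on {0..x} (ext_deriv h)"
    using assms(1) unfolding C1_halfline_def by (meson atLeastAtMost_iff atLeast_iff continuous_on_subset subsetI)
  ultimately have "\<exists>z\<ge>0. z \<le> x \<and> ext_deriv h z = c"
    using assms(2) by (intro IVT2') (auto intro: less_imp_le)
  then have "c \<in> ext_deriv h ` {0..}" by auto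
  from inv_into_into[OF this] show ?thesis
    by (simp add: deriv_inverse_def)
qed

lemma hat_a1_nonneg:
  assumes "C1_halfline \<psi>" "ext_deriv \<psi> 0 = \<infinity>" "(ext_deriv \<psi> \<longlongrightarrow> 0) at_top"
    and "0 < u" "0 < v" "0 \<le> r\<^sub>J"
  shows "0 \<le> hat_a1 \<psi> u v \<delta> r\<^sub>J"
proof -
  have num: "0 < (u + v) * (1 + r\<^sub>J)"
    using assms(4-6) by simp
  have "0 < ereal ((u + v) * (1 + r\<^sub>J)) / ereal (max \<delta> 0 * u)"
  proof (cases "\<delta> > 0")
    case True
    with num assms(4) have "0 < (u + v) * (1 + r\<^sub>J) / (\<delta> * u)" by simp
    with True assms(4) show ?thesis by (simp add: max_def)
  next
    \<comment> \<open>For \<delta> \<le> 0 the divisor is \<open>ereal 0\<close>, so the quotient is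
      \<open>\<infinity>\<close>, which is still positive.\<close>
    case False
    with num show ?thesis by (auto simp: max_def divide_ereal_def)
  qed
  then show ?thesis
    unfolding hat_a1_def by (rule deriv_inverse_nonneg[OF assms(1-3)])
qed

text \<open>\<open>GREATEST\<close> is meaningful only if a greatest value exists. Membership in
  \<open>hat_M2\<close> supplies a maximiser, so \<open>hat_I2\<close> is a maximum that is
  attained.\<close>

lemma objective2_le_hat_I2:
  assumes "m \<in> hat_M2 M \<mu> \<phi> \<psi> g ba bm be f u v \<delta> D r" "0 \<le> a"
  shows "objective2 M \<mu> \<phi> \<psi> ba bm be f u v \<delta> D r m a \<le> hat_I2 M \<mu> \<phi> \<psi> ba bm be f u v \<delta> D r m"
proof -
  let ?J = "objective2 M \<mu> \<phi> \<psi> ba bm be f u v \<delta> D r m"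
  from assms(1) obtain a' where a': "0 \<le> a'" "\<And>x. 0 \<le> x \<Longrightarrow> ?J x \<le> ?J a'"
    by (auto simp: hat_M2_def is_arg_max_linorder)
  have "hat_I2 M \<mu> \<phi> \<psi> ba bm be f u v \<delta> D r m = ?J a'"
    unfolding hat_I2_def by (rule Greatest_equality) (use a' in auto)
  with a'(2)[OF assms(2)] show ?thesis by simp
qed

theorem theorem3:
  fixes M :: "'w measure" and \<mu> :: "'w \<Rightarrow> real" and \<mu>_low :: real
    and \<phi> \<psi> g ba bm be f :: "real \<Rightarrow> real"
    and u v \<delta> D r\<^sub>I r\<^sub>J m :: real
  assumes "u > 0" and "v > 0" and "D > 0" and "r\<^sub>I \<ge> 0" and "r\<^sub>J \<ge> 0"
    and "prob_space M"
    and "\<mu> \<in> borel_measurable M"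
    and "\<not> (\<exists>c. AE \<omega> in M. \<mu> \<omega> = c)"
    and "AE \<omega> in M. \<mu>_low \<le> \<mu> \<omega>"
    and "\<And>s::real. integrable M (\<lambda>\<omega>. exp (s * \<mu> \<omega>))"
    and "\<forall>x\<ge>0. \<phi> x \<ge> 0" and "C1_halfline \<phi>" and "mono_on {0..} \<phi>"
    and "strictly_concave_on {0..} \<phi>"
    and "ext_deriv \<phi> 0 = \<infinity>" and "(ext_deriv \<phi> \<longlongrightarrow> 0) at_top"
    and "\<forall>x\<ge>0. \<psi> x \<ge> 0" and "C1_halfline \<psi>" and "mono_on {0..} \<psi>"
    and "strictly_concave_on {0..} \<psi>"
    and "ext_deriv \<psi> 0 = \<infinity>" and "(ext_deriv \<psi> \<longlongrightarrow> 0) at_top"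
    and "limit_at_infinity \<phi> + ereal (max \<delta> 0) * limit_at_infinity \<psi> < ereal \<mu>_low"
    and "(\<lambda>x. deriv_inverse \<phi> (ereal x)) \<sim>[at_right 0] (\<lambda>x. deriv_inverse \<psi> (ereal x))"
    and "C1_halfline g" and "mono_on {0..} g" and "strictly_concave_on {0..} g"
    and "ext_deriv g 0 = \<infinity>" and "(ext_deriv g \<longlongrightarrow> 0) at_top"
    and "\<exists>m>0. g m > 0"
    and "\<forall>x\<ge>0. ba x \<ge> 0" and "C1_halfline ba" and "mono_on {0..} ba" and "concave_on {0..} ba"
    and "ext_deriv ba 0 > 0" and "(ext_deriv ba \<longlongrightarrow> 0) at_top" and "limit_at_infinity ba < \<infinity>"
    and "\<forall>x\<ge>0. bm x \<ge> 0" and "C1_halfline bm" and "mono_on {0..} bm" and "concave_on {0..} bm"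
    and "ext_deriv bm 0 = \<infinity>" and "(ext_deriv bm \<longlongrightarrow> 0) at_top"
    and "\<forall>x\<ge>0. be x \<ge> 0" and "C1_halfline be" and "mono_on {0..} be" and "concave_on {0..} be"
    and "ext_deriv be 0 = \<infinity>" and "(ext_deriv be \<longlongrightarrow> 0) at_top"
    and "f differentiable_on {0..}" and "mono_on {0..} f" and "strictly_convex_on {0..} f"
    and "(ext_deriv f \<longlongrightarrow> \<infinity>) at_top"
    and "ext_deriv (F_fun ba f D r\<^sub>I) 0 > 0"
    and "m \<in> hat_M1 M \<mu> \<phi> \<psi> g u v \<delta> D r\<^sub>J
           \<inter> (\<Inter>r\<in>{0..}. hat_M2 M \<mu> \<phi> \<psi> g ba bm be f u v \<delta> D r)"
    and "B_fun M \<mu> \<phi> bm be u v m * exp (- u * \<delta> * \<psi> (hat_a1 \<psi> u v \<delta> r\<^sub>J))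
           * (exp (u * (1 + r\<^sub>J) * (D + hat_a1 \<psi> u v \<delta> r\<^sub>J)) - 1) \<in> f ` {0..}"
    and "r\<^sub>I \<le> inv_into {0..} f
             (B_fun M \<mu> \<phi> bm be u v m * exp (- u * \<delta> * \<psi> (hat_a1 \<psi> u v \<delta> r\<^sub>J))
               * (exp (u * (1 + r\<^sub>J) * (D + hat_a1 \<psi> u v \<delta> r\<^sub>J)) - 1))
           / (D + hat_a1 \<psi> u v \<delta> r\<^sub>J) - 1"
  shows "hat_I2 M \<mu> \<phi> \<psi> ba bm be f u v \<delta> D r\<^sub>I m \<ge> hat_I1 M \<mu> \<phi> \<psi> ba bm be u v \<delta> D r\<^sub>J m"
proof -
  define a where "a = hat_a1 \<psi> u v \<delta> r\<^sub>J"
  define y where "y = B_fun M \<mu> \<phi> bm be u v m * exp (- u * \<delta> * \<psi> a)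
    * (exp (u * (1 + r\<^sub>J) * (D + a)) - 1)"
  note y_facts = assms(56,57)[folded a_def, folded y_def]
  have a: "0 \<le> a"
    unfolding a_def using assms(18,21,22,1,2,5) by (rule hat_a1_nonneg)
  \<comment> \<open>Since \<open>D + a\<close> is positive, the denominator in the bound on the rate
    can be cleared.\<close>
  have "(1 + r\<^sub>I) * (D + a) \<le> inv_into {0..} f y"
    using y_facts(2) a \<open>D > 0\<close> by (simp add: field_simps)
  \<comment> \<open>Monotonicity of \<open>f\<close> is known on the half-line only; the right-hand
    point lies there because \<open>y\<close> is in the range of \<open>f\<close>.\<close>
  then have "f ((1 + r\<^sub>I) * (D + a)) \<le> f (inv_into {0..} f y)"
    using \<open>mono_on {0..} f\<close> inv_into_into[OF y_facts(1)] a \<open>D > 0\<close> \<open>r\<^sub>I \<ge> 0\<close>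
    by (intro mono_onD[of "{0..}" f]) auto
  also have "\<dots> = y"
    using y_facts(1) by (rule f_inv_into_f)
  \<comment> \<open>The terms \<open>ba a\<close> cancel, and the right side minus the left side is
    exactly \<open>y - f ((1 + r\<^sub>I) * (D + a))\<close>.\<close>
  finally have "hat_I1 M \<mu> \<phi> \<psi> ba bm be u v \<delta> D r\<^sub>J m
      \<le> objective2 M \<mu> \<phi> \<psi> ba bm be f u v \<delta> D r\<^sub>I m a"
    unfolding hat_I1_def objective2_def F_fun_def a_def[symmetric] y_def
    by (simp add: algebra_simps)
  \<comment> \<open>The intersection over all rates is used at the rate
    \<open>r\<^sub>I\<close>.\<close>
  also have "\<dots> \<le> hat_I2 M \<mu> \<phi> \<psi> ba bm be f u v \<delta> D r\<^sub>I m"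
    using assms(55) \<open>r\<^sub>I \<ge> 0\<close> a by (intro objective2_le_hat_I2) auto
  finally show ?thesis .
qed

end
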